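(* Let $M$ be a finite metric space with at least two points. If $M$ does not satisfy the min-condition, then the infimum of all seminorms $\|\cdot\|_{\mathcal{K}}$ on $\mathrm{TP}(M)$ over all $\mathcal{K}$ satisfying conditions (A) and (B), i.e. the function $f\mapsto \inf_{\mathcal{K}}\|f\|_{\mathcal{K}}$ on $\mathrm{TP}(M)$, is not a seminorm.
   Context: Let $(M,d)$ be a metric space. $\mathrm{TP}(M)$ is the real vector space of all finitely supported functions $f:M\to\mathbb{R}$ with $\sum_{v\in M}f(v)=0$. For a set $\mathcal{K}$ of real-valued functions on $M$, conditions (A) and (B) are: (A) every function in $\mathcal{K}$ is $1$-Lipschitz; (B) for every $u,v\in M$ there is $l\in\mathcal{K}$ with $|l(u)-l(v)|=d(u,v)$. For $\mathcal{K}$ satisfying (A) and (B), define the seminorm $\|f\|_{\mathcal{K}}=\sup_{l\in\mathcal{K}}|l(f)|$, where $l(f)=\sum_{v\in M}l(v)f(v)$. A collection $r_1,\dots,r_n$, $n\ge3$, of points in $M$ is a linear tuple if the sequence $d(r_i,r_1)$, $i=1,\dots,n$, is strictly increasing and $d(r_i,r_k)=d(r_i,r_j)+d(r_j,r_k)$ for all $1\le i<j<k\le n$. A linear triple is a linear tuple with $n=3$. A metric space $M$ (with at least two points) satisfies the min-condition if it contains a finite set of pairs $\{u_i,v_i\}$ ($i\in\mathcal{I}$) such that: (I) for each $i\in\mathcal{I}$, every point $x\in M$ different from $u_i$ and $v_i$ is such that $u_i,x,v_i$ is a linear triple; (II) for each pair $\{x,y\}$ of distinct points in $M$ there is $i\in\mathcal{I}$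 such that exactly one of the following four conditions holds: (1) the pairs $\{x,y\}$ and $\{u_i,v_i\}$ coincide; (2) exactly one of the points $x,y$ coincides with one of the points $u_i,v_i$, and the remaining one of $x,y$, denoted $z$, is such that $u_i,z,v_i$ is a linear triple; (3) $u_i,x,y,v_i$ is a linear tuple; (4) $u_i,y,x,v_i$ is a linear tuple. *)

theory Defs
  imports "HOL-Analysis.Analysis"
begin

definition TP :: "('a \<Rightarrow> real) set" where
  "TP = {f. finite {v. f v \<noteq> 0} \<and> (\<Sum>v | f v \<noteq> 0. f v) = 0}"

definition pairing :: "('a \<Rightarrow> real) \<Rightarrow> ('a \<Rightarrow> real) \<Rightarrow> real" where
  "pairing l f = (\<Sum>v | f v \<noteq> 0. l v * f v)"

definition condition_A :: "('a::metric_space \<Rightarrow> real) set \<Rightarrow> bool" where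
  "condition_A K \<longleftrightarrow> (\<forall>l\<in>K. 1-lipschitz_on UNIV l)"

definition condition_B :: "('a::metric_space \<Rightarrow> real) set \<Rightarrow> bool" where
  "condition_B K \<longleftrightarrow> (\<forall>u v. \<exists>l\<in>K. \<bar>l u - l v\<bar> = dist u v)"

(* Condition (B) makes K nonempty. For f in TP, condition (A) bounds the set of values:
   fixing a base point w, |l(f)| is at most the sum of d(v,w) * |f(v)|. Hence the real-valued
   supremum is the intended one whenever K satisfies (A) and (B). *)
definition K_norm :: "('a \<Rightarrow> real) set \<Rightarrow> ('a \<Rightarrow> real) \<Rightarrow> real" where
  "K_norm K f = (SUP l\<in>K. \<bar>pairing l f\<bar>)"

(* On TP the infimum is over a nonempty set of reals (the set of all 1-Lipschitz functions
   satisfies (A) and (B)) that is bounded below by 0. *)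
definition inf_K_norm :: "('a::metric_space \<Rightarrow> real) \<Rightarrow> real" where
  "inf_K_norm f = (INF K\<in>{K. condition_A K \<and> condition_B K}. K_norm K f)"

(* V is meant to be a linear subspace of the space of all real functions on 'a, with the
   pointwise operations. *)
definition seminorm_on :: "('a \<Rightarrow> real) set \<Rightarrow> (('a \<Rightarrow> real) \<Rightarrow> real) \<Rightarrow> bool" where
  "seminorm_on V p \<longleftrightarrow>
     (\<forall>f\<in>V. 0 \<le> p f) \<and>
     (\<forall>c. \<forall>f\<in>V. p (\<lambda>v. c * f v) = \<bar>c\<bar> * p f) \<and>
     (\<forall>f\<in>V. \<forall>g\<in>V. p (\<lambda>v. f v + g v) \<le> p f + p g)"

definition linear_tuple :: "'a::metric_space list \<Rightarrow> bool" where
  "linear_tuple rs \<longleftrightarrow>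
     3 \<le> length rs \<and>
     sorted_wrt (<) (map (\<lambda>r. dist r (rs ! 0)) rs) \<and>
     (\<forall>i j k. i < j \<and> j < k \<and> k < length rs \<longrightarrow>
        dist (rs ! i) (rs ! k) = dist (rs ! i) (rs ! j) + dist (rs ! j) (rs ! k))"

definition linear_triple :: "'a::metric_space \<Rightarrow> 'a \<Rightarrow> 'a \<Rightarrow> bool" where
  "linear_triple x y z \<longleftrightarrow> linear_tuple [x, y, z]"

definition exactly_one :: "bool list \<Rightarrow> bool" where
  "exactly_one ps \<longleftrightarrow> (\<exists>!k. k < length ps \<and> ps ! k)"

(* The pairs {u_i,v_i} are unordered; each is represented by some ordered pair (u,v) in P with
   distinct components. All conditions below are invariant under exchanging u and v. *)
definition min_condition :: "'a::metric_space itself \<Rightarrow> bool" where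
  "min_condition T \<longleftrightarrow>
     (\<exists>P :: ('a \<times> 'a) set. finite P \<and> (\<forall>(u, v)\<in>P. u \<noteq> v) \<and>
        (\<forall>(u, v)\<in>P. \<forall>x. x \<noteq> u \<and> x \<noteq> v \<longrightarrow> linear_triple u x v) \<and>
        (\<forall>x y. x \<noteq> y \<longrightarrow> (\<exists>(u, v)\<in>P. exactly_one
           [{x, y} = {u, v},
            (x \<in> {u, v} \<and> y \<notin> {u, v} \<and> linear_triple u y v) \<or>
              (y \<in> {u, v} \<and> x \<notin> {u, v} \<and> linear_triple u x v),
            linear_tuple [u, x, y, v],
            linear_tuple [u, y, x, v]])))"

end

theory Submission
  imports Defs
begin

text \<open>Suppose the infimum \<open>p\<close> is a seminorm. Fix \<open>x \<noteq> y\<close> and take a maximal set \<open>T\<close> of ordered pairs,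
  containing \<open>(x, y)\<close>, such that \<open>p(f) = D\<close>, where \<open>f\<close> is the sum of \<open>1\<^sub>b - 1\<^sub>a\<close> and \<open>D\<close> the sum of
  \<open>d(a, b)\<close> over \<open>(a, b) \<in> T\<close>. Since a family \<open>\<K>\<close> may choose its function for each pair freely,
  \<open>p(f) = D\<close> forces a pair \<open>(u, v)\<close> for which every 1-Lipschitz \<open>l\<close> with \<open>l(v) - l(u) = d(u, v)\<close>
  satisfies \<open>l(f) = D\<close>. Near \<open>f\<close>, \<open>p\<close> is bounded by the minimum of all these \<open>l\<close>, and such a minimum
  is compatible with convexity only if the \<open>l\<close> agree up to constants. Comparing \<open>d(u, \<cdot>)\<close> with
  \<open>- d(v, \<cdot>)\<close> puts every point of the space between \<open>u\<close> and \<open>v\<close>, while \<open>(x, y) \<in> T\<close> shows that \<open>d(u, \<cdot>)\<close>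
  increases by \<open>d(x, y)\<close> from \<open>x\<close> to \<open>y\<close>. The pairs \<open>(u, v)\<close> obtained in this way witness the
  min-condition.\<close>

section \<open>Pairings on a finite space and upper bounds for the infimum\<close>

lemma pairing_UNIV:
  fixes f :: "'a::finite \<Rightarrow> real"
  shows "pairing l f = (\<Sum>v\<in>UNIV. l v * f v)"
  unfolding pairing_def by (rule sum.mono_neutral_left) auto

lemma TP_UNIV:
  fixes f :: "'a::finite \<Rightarrow> real"
  shows "f \<in> TP \<longleftrightarrow> (\<Sum>v\<in>UNIV. f v) = 0"
proof -
  have "(\<Sum>v | f v \<noteq> 0. f v) = (\<Sum>v\<in>UNIV. f v)"
    by (rule sum.mono_neutral_left) auto
  then show ?thesis by (simp add: TP_def)
qed

lemma pairing_lincomb: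
  fixes f g :: "'a::finite \<Rightarrow> real"
  shows "pairing l (\<lambda>v. a * f v + b * g v) = a * pairing l f + b * pairing l g"
  by (simp add: pairing_UNIV algebra_simps sum.distrib sum_distrib_left)

lemma TP_lincomb:
  fixes f g :: "'a::finite \<Rightarrow> real"
  assumes "f \<in> TP" "g \<in> TP"
  shows "(\<lambda>v. a * f v + b * g v) \<in> TP"
  using assms by (simp add: TP_UNIV sum.distrib flip: sum_distrib_left)

text \<open>Since \<open>f\<close> has total mass 0, \<open>l\<close> may be shifted to vanish at
  \<open>w\<close>. The bound is uniform in \<open>l\<close>, so the suprema in
  \<open>K_norm\<close> are finite.\<close>

lemma pairing_bound:
  fixes f :: "'a::{metric_space,finite} \<Rightarrow> real"
  assumes "1-lipschitz_on UNIV l" "f \<in> TP"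
  shows "\<bar>pairing l f\<bar> \<le> (\<Sum>v\<in>UNIV. dist v w * \<bar>f v\<bar>)"
proof -
  have "pairing l f = (\<Sum>v\<in>UNIV. (l v - l w) * f v)"
    using assms(2)
    by (simp add: pairing_UNIV TP_UNIV left_diff_distrib sum_subtractf flip: sum_distrib_left)
  also have "\<bar>\<dots>\<bar> \<le> (\<Sum>v\<in>UNIV. \<bar>l v - l w\<bar> * \<bar>f v\<bar>)"
    by (rule order_trans[OF sum_abs]) (simp add: abs_mult)
  also have "\<dots> \<le> (\<Sum>v\<in>UNIV. dist v w * \<bar>f v\<bar>)"
    using lipschitz_onD[OF assms(1)] by (intro sum_mono mult_right_mono) (auto simp: dist_real_def)
  finally show ?thesis .
qed

lemma pairing_le_K_norm:
  fixes f :: "'a::{metric_space,finite} \<Rightarrow> real"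
  assumes "condition_A K" "f \<in> TP" "l \<in> K"
  shows "\<bar>pairing l f\<bar> \<le> K_norm K f"
  unfolding K_norm_def
proof (rule cSUP_upper)
  show "bdd_above ((\<lambda>l. \<bar>pairing l f\<bar>) ` K)"
    using pairing_bound assms by (fastforce simp: condition_A_def bdd_above_def)
qed fact

lemma inf_K_norm_le:
  fixes f :: "'a::{metric_space,finite} \<Rightarrow> real"
  assumes "condition_A K" "condition_B K" "f \<in> TP"
  shows "inf_K_norm f \<le> K_norm K f"
  unfolding inf_K_norm_def
proof (rule cINF_lower)
  have "0 \<le> K_norm K' f" if A: "condition_A K'" and B: "condition_B K'" for K' :: "('a \<Rightarrow> real) set"
  proof -
    obtain l where "l \<in> K'" using B by (auto simp: condition_B_def)
    then show ?thesis using pairing_le_K_norm[OF A assms(3)] by fastforce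
  qed
  then show "bdd_below ((\<lambda>K. K_norm K f) ` {K. condition_A K \<and> condition_B K})"
    by (auto simp: bdd_below_def)
qed (use assms in auto)

section \<open>Steep functions and lower bounds for the infimum\<close>

definition steep :: "'a::metric_space \<Rightarrow> 'a \<Rightarrow> ('a \<Rightarrow> real) \<Rightarrow> bool" where
  "steep u v l \<longleftrightarrow> 1-lipschitz_on UNIV l \<and> l v - l u = dist u v"

lemma lipschitz_le:
  "1-lipschitz_on UNIV l \<Longrightarrow> l b - l a \<le> dist a b" for l :: "'a::metric_space \<Rightarrow> real"
  using lipschitz_onD[of 1 UNIV l a b] by (auto simp: dist_real_def)

lemma lipschitz_real_I:
  fixes l :: "'a::metric_space \<Rightarrow> real"
  assumes "\<And>a b. l b - l a \<le> dist a b"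
  shows "1-lipschitz_on UNIV l"
proof (rule lipschitz_onI)
  show "dist (l a) (l b) \<le> 1 * dist a b" for a b
    using assms[of a b] assms[of b a] by (auto simp: dist_real_def dist_commute)
qed simp

lemma steep_abs: "steep u v l \<Longrightarrow> \<bar>l u - l v\<bar> = dist u v"
  unfolding steep_def by (metis abs_minus_commute abs_of_nonneg zero_le_dist)

text \<open>Among the functions steep from \<open>u\<close> to \<open>v\<close> and vanishing at
  \<open>u\<close>, \<open>dist u\<close> is the largest; \<open>- dist v\<close>, shifted by
  \<open>dist u v\<close>, is the smallest. Rigidity is later tested on these two.\<close>

lemma steep_dist_from: "steep u v (dist u)"
proof -
  have "dist u b - dist u a \<le> dist a b" for a b using dist_triangle[of u b a] by simp
  then show ?thesis unfolding steep_def by (auto intro: lipschitz_real_I)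
qed

lemma steep_dist_to: "steep u v (\<lambda>x. - dist v x)"
proof -
  have "- dist v b - - dist v a \<le> dist a b" for a b
    using dist_triangle[of v a b] by (simp add: dist_commute)
  then show ?thesis unfolding steep_def
    by (auto intro: lipschitz_real_I simp: dist_commute)
qed

lemma steep_uminus: "steep u v (\<lambda>x. - l x) \<longleftrightarrow> steep v u l"
proof -
  have "1-lipschitz_on UNIV (\<lambda>x. - l x) \<longleftrightarrow> 1-lipschitz_on UNIV l"
    by (auto simp: lipschitz_on_def dist_real_def abs_minus_commute)
  then show ?thesis by (auto simp: steep_def dist_commute)
qed

lemma steep_midpoint:
  assumes "steep u v k" "steep u v l"
  shows "steep u v (\<lambda>x. (k x + l x) / 2)"
proof -
  have "(k b + l b) / 2 - (k a + l a) / 2 \<le> dist a b" for a b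
  proof -
    have "k b - k a \<le> dist a b" "l b - l a \<le> dist a b"
      using assms by (auto simp: steep_def intro: lipschitz_le)
    then show ?thesis by (simp add: field_simps)
  qed
  moreover have "(k v + l v) / 2 - (k u + l u) / 2 = dist u v"
    using assms by (simp add: steep_def field_simps)
  ultimately show ?thesis unfolding steep_def by (auto intro: lipschitz_real_I)
qed

lemma pairing_uminus_left: "pairing (\<lambda>x. - l x) f = - pairing l f"
  by (simp add: pairing_def sum_negf)

lemma pairing_midpoint_left:
  "pairing (\<lambda>x. (k x + l x) / 2) f = (pairing k f + pairing l f) / 2"
  by (simp add: pairing_def sum.distrib add_divide_distrib ring_distribs flip: sum_divide_distrib)

lemma condition_B_steep:
  assumes "condition_A K" "condition_B K"
  obtains l where "l \<in> K" "steep u v l \<or> steep u v (\<lambda>x. - l x)"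
proof -
  obtain l where l: "l \<in> K" "\<bar>l u - l v\<bar> = dist u v"
    using assms(2) by (auto simp: condition_B_def)
  moreover have "1-lipschitz_on UNIV l" using assms(1) l(1) by (auto simp: condition_A_def)
  ultimately have "steep u v l \<or> steep u v (\<lambda>x. - l x)"
    unfolding steep_uminus by (auto simp: steep_def dist_commute abs_if split: if_splits)
  with l(1) that show ?thesis by blast
qed

text \<open>By (B), every family contains a function that is steep from \<open>u\<close> to
  \<open>v\<close> up to sign, and the modulus in \<open>K_norm\<close> hides the sign. A single
  pair thus bounds all families at once.\<close>

lemma inf_K_norm_ge:
  fixes f :: "'a::{metric_space,finite} \<Rightarrow> real"
  assumes "f \<in> TP" and ge: "\<And>l. steep u v l \<Longrightarrow> c \<le> pairing l f"
  shows "c \<le> inf_K_norm f"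
  unfolding inf_K_norm_def
proof (rule cINF_greatest)
  have "condition_B {l::'a \<Rightarrow> real. 1-lipschitz_on UNIV l}"
    unfolding condition_B_def
  proof (intro allI)
    fix a b :: 'a
    show "\<exists>l\<in>{l. 1-lipschitz_on UNIV l}. \<bar>l a - l b\<bar> = dist a b"
      using steep_dist_from[of a b] by (intro bexI[of _ "dist a"]) (auto simp: steep_def)
  qed
  then show "{K::('a \<Rightarrow> real) set. condition_A K \<and> condition_B K} \<noteq> {}"
    by (auto simp: condition_A_def)
next
  fix K :: "('a \<Rightarrow> real) set" assume "K \<in> {K. condition_A K \<and> condition_B K}"
  then have K: "condition_A K" "condition_B K" by auto
  obtain l where l: "l \<in> K" "steep u v l \<or> steep u v (\<lambda>x. - l x)"
    using condition_B_steep[OF K] .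
  then have "c \<le> \<bar>pairing l f\<bar>"
    using ge[of l] ge[of "\<lambda>x. - l x"] by (auto simp: pairing_uminus_left)
  then show "c \<le> K_norm K f"
    using pairing_le_K_norm[OF K(1) assms(1) l(1)] by simp
qed

section \<open>Dominant pairs and an upper bound for the infimum near \<open>f\<close>\<close>

definition dominant :: "real \<Rightarrow> ('a::metric_space \<Rightarrow> real) \<Rightarrow> 'a \<Rightarrow> 'a \<Rightarrow> bool" where
  "dominant D f u v \<longleftrightarrow> u \<noteq> v \<and> (\<forall>l. steep u v l \<longrightarrow> pairing l f = D)"

text \<open>A good family serves every dominant pair with the same \<open>m\<close> and every other
  pair with a function whose modulus on \<open>f\<close> is strictly below \<open>D\<close>. For
  small \<open>e\<close> only \<open>m\<close> can determine the supremum, whence the slope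
  \<open>pairing m g\<close>.\<close>

lemma inf_K_norm_perturb:
  fixes f g :: "'a::{metric_space,finite} \<Rightarrow> real"
  assumes TP: "f \<in> TP" "g \<in> TP" and "D > 0"
    and le: "\<And>l. 1-lipschitz_on UNIV l \<Longrightarrow> pairing l f \<le> D"
    and m: "\<And>u v. dominant D f u v \<Longrightarrow> steep u v m"
  shows "\<forall>\<^sub>F e in at_right 0. inf_K_norm (\<lambda>v. f v + e * g v) \<le> D + e * pairing m g"
proof -
  let ?ok = "\<lambda>u v l. 1-lipschitz_on UNIV l \<and> \<bar>l u - l v\<bar> = dist u v \<and>
      (\<bar>pairing l f\<bar> < D \<or> l = m \<and> pairing m f = D)"
  have ge: "- D \<le> pairing l f" if "1-lipschitz_on UNIV l" for l
  proof -
    have "1-lipschitz_on UNIV (\<lambda>x. - l x)"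
      using that by (auto simp: lipschitz_on_def dist_real_def abs_minus_commute)
    from le[OF this] show ?thesis by (simp add: pairing_uminus_left)
  qed
  have "\<exists>l. ?ok u v l" for u v
  proof -
    consider "u = v" | "dominant D f u v" | "dominant D f v u"
      | "u \<noteq> v" "\<not> dominant D f u v" "\<not> dominant D f v u" by blast
    then show ?thesis
    proof cases
      case 1
      have "?ok u v (\<lambda>_. 0)" using 1 \<open>D > 0\<close> by (auto simp: pairing_def lipschitz_on_def)
      then show ?thesis by blast
    next
      case 2
      then have "?ok u v m" using m[OF 2] steep_abs[of u v m] by (auto simp: dominant_def steep_def)
      then show ?thesis by blast
    next
      \<comment> \<open>(B) ignores orientation, so \<open>m\<close> also serves the reversed
        pair.\<close>
      case 3
      then have "?ok u v m" using m[OF 3] steep_abs[of v u m]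
        by (auto simp: dominant_def steep_def dist_commute abs_minus_commute)
      then show ?thesis by blast
    next
      case 4
      \<comment> \<open>The function \<open>k\<close> avoids the value D and \<open>-l\<close>
        avoids -D. Both are steep from \<open>u\<close> to \<open>v\<close> with values in [-D, D],
        so their average lies strictly inside.\<close>
      then obtain k l where k: "steep u v k" "pairing k f \<noteq> D"
        and l: "steep v u l" "pairing l f \<noteq> D" by (auto simp: dominant_def)
      let ?l = "\<lambda>x. - l x"
      have l': "steep u v ?l" "pairing ?l f \<noteq> - D"
        using l by (auto simp: steep_uminus pairing_uminus_left)
      let ?h = "\<lambda>x. (k x + ?l x) / 2"
      have h: "steep u v ?h" by (rule steep_midpoint[OF k(1) l'(1)])
      have "pairing k f \<le> D" "- D \<le> pairing k f" "pairing ?l f \<le> D" "- D \<le> pairing ?l f"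
        using le ge k(1) l'(1) by (auto simp: steep_def)
      then have "\<bar>pairing ?h f\<bar> < D"
        using k(2) l'(2) \<open>D > 0\<close> unfolding pairing_midpoint_left by auto
      then have "?ok u v ?h" using h steep_abs[OF h] by (auto simp: steep_def)
      then show ?thesis by blast
    qed
  qed
  then obtain L where L: "\<And>u v. ?ok u v (L u v)" by metis
  define K where "K = range (\<lambda>(u, v). L u v)"
  have A: "condition_A K" and B: "condition_B K"
    using L by (auto simp: K_def condition_A_def condition_B_def)
  have fin: "finite K" by (simp add: K_def)
  have pair: "pairing l (\<lambda>v. f v + e * g v) = pairing l f + e * pairing l g" for l e
    using pairing_lincomb[of l 1 f e g] by simp
  have "\<forall>\<^sub>F e in at_right 0. \<bar>pairing l (\<lambda>v. f v + e * g v)\<bar> \<le> D + e * pairing m g"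
    if "l \<in> K" for l
  proof (cases "\<bar>pairing l f\<bar> < D")
    case True
    \<comment> \<open>At \<open>e = 0\<close> there is the positive slack
      \<open>D - \<bar>pairing l f\<bar>\<close>, which persists by continuity.\<close>
    have "((\<lambda>e. D + e * pairing m g - \<bar>pairing l f + e * pairing l g\<bar>)
        \<longlongrightarrow> D + 0 * pairing m g - \<bar>pairing l f + 0 * pairing l g\<bar>) (at_right 0)"
      by (intro tendsto_intros)
    then have "\<forall>\<^sub>F e in at_right 0. 0 < D + e * pairing m g - \<bar>pairing l f + e * pairing l g\<bar>"
      by (rule order_tendstoD) (use True in auto)
    then show ?thesis unfolding pair by (rule eventually_mono) auto
  next
    case False
    then have lm: "l = m" "pairing m f = D" using L that by (auto simp: K_def)
    have "((\<lambda>e. D + e * pairing m g) \<longlongrightarrow> D + 0 * pairing m g) (at_right 0)"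
      by (intro tendsto_intros)
    then have "\<forall>\<^sub>F e in at_right 0. 0 < D + e * pairing m g"
      by (rule order_tendstoD) (use \<open>D > 0\<close> in auto)
    then show ?thesis unfolding pair lm by (rule eventually_mono) auto
  qed
  \<comment> \<open>One function per pair makes \<open>K\<close> finite, so the thresholds for
    \<open>e\<close> have a common one.\<close>
  then have "\<forall>\<^sub>F e in at_right 0. \<forall>l\<in>K. \<bar>pairing l (\<lambda>v. f v + e * g v)\<bar> \<le> D + e * pairing m g"
    using fin by (simp add: eventually_ball_finite_distrib)
  then show ?thesis
  proof (rule eventually_mono)
    fix e assume *: "\<forall>l\<in>K. \<bar>pairing l (\<lambda>v. f v + e * g v)\<bar> \<le> D + e * pairing m g"
    have "(\<lambda>v. f v + e * g v) \<in> TP" using TP_lincomb[OF TP, of 1 e] by simp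
    then have "inf_K_norm (\<lambda>v. f v + e * g v) \<le> K_norm K (\<lambda>v. f v + e * g v)"
      by (rule inf_K_norm_le[OF A B])
    also have "\<dots> \<le> D + e * pairing m g"
      unfolding K_norm_def using * by (intro cSUP_least) (auto simp: K_def)
    finally show "inf_K_norm (\<lambda>v. f v + e * g v) \<le> D + e * pairing m g" .
  qed
qed

section \<open>Transport plans and their costs\<close>

definition transport :: "('a \<times> 'a) set \<Rightarrow> 'a \<Rightarrow> real" where
  "transport T w = (\<Sum>(a, b)\<in>T. of_bool (w = b) - of_bool (w = a))"

definition cost :: "('a::metric_space \<times> 'a) set \<Rightarrow> real" where
  "cost T = (\<Sum>(a, b)\<in>T. dist a b)"

lemma transport_TP: "transport T \<in> TP" for T :: "('a::finite \<times> 'a) set"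
proof -
  have "(\<Sum>w\<in>UNIV. transport T w)
      = (\<Sum>(a, b)\<in>T. \<Sum>w\<in>UNIV. of_bool (w = b) - of_bool (w = a))"
    unfolding transport_def by (subst sum.swap) (simp add: case_prod_beta)
  also have "\<dots> = 0" by (simp add: sum_subtractf of_bool_def)
  finally show ?thesis by (simp add: TP_UNIV)
qed

lemma pairing_transport:
  "pairing l (transport T) = (\<Sum>(a, b)\<in>T. l b - l a)" for T :: "('a::finite \<times> 'a) set"
proof -
  have "pairing l (transport T)
      = (\<Sum>(a, b)\<in>T. \<Sum>w\<in>UNIV. l w * (of_bool (w = b) - of_bool (w = a)))"
    unfolding transport_def pairing_UNIV sum_distrib_left
    by (subst sum.swap) (simp add: case_prod_beta)
  also have "\<dots> = (\<Sum>(a, b)\<in>T. l b - l a)"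
    by (simp add: right_diff_distrib sum_subtractf of_bool_def if_distrib[of "(*) _"] cong: if_cong)
  finally show ?thesis .
qed

lemma pairing_transport_le:
  fixes T :: "('a::{metric_space,finite} \<times> 'a) set"
  assumes "1-lipschitz_on UNIV l"
  shows "pairing l (transport T) \<le> cost T"
  unfolding pairing_transport cost_def
  using lipschitz_le[OF assms] by (intro sum_mono) auto

text \<open>The bound by the cost holds termwise, so equality of the sums forces equality in each
  term. This is complementary slackness for optimal transport.\<close>

lemma pairing_transport_eq_iff:
  fixes T :: "('a::{metric_space,finite} \<times> 'a) set"
  assumes "1-lipschitz_on UNIV l"
  shows "pairing l (transport T) = cost T \<longleftrightarrow> (\<forall>(a, b)\<in>T. steep a b l)"
proof
  assume "pairing l (transport T) = cost T"
  then have "(\<Sum>(a, b)\<in>T. dist a b - (l b - l a)) = 0"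
    by (simp add: pairing_transport cost_def case_prod_beta sum_subtractf)
  then have "\<forall>x\<in>T. (case x of (a, b) \<Rightarrow> dist a b - (l b - l a)) = 0"
    using lipschitz_le[OF assms] by (subst (asm) sum_nonneg_eq_0_iff) auto
  then show "\<forall>(a, b)\<in>T. steep a b l" using assms by (auto simp: steep_def)
next
  assume "\<forall>(a, b)\<in>T. steep a b l"
  then show "pairing l (transport T) = cost T"
    unfolding pairing_transport cost_def by (intro sum.cong) (auto simp: steep_def)
qed

section \<open>Consequences of the infimum being a seminorm\<close>

lemma seminorm_on_scale:
  "seminorm_on V p \<Longrightarrow> f \<in> V \<Longrightarrow> p (\<lambda>v. c * f v) = \<bar>c\<bar> * p f"
  by (simp add: seminorm_on_def)

lemma seminorm_on_add:
  "seminorm_on V p \<Longrightarrow> f \<in> V \<Longrightarrow> g \<in> V \<Longrightarrow> p (\<lambda>v. f v + g v) \<le> p f + p g"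
  by (simp add: seminorm_on_def)

text \<open>Without dominant pairs the requirement on \<open>m\<close> is vacuous, so
  \<open>m = 0\<close> is allowed. Perturbing \<open>f\<close> in its own direction then keeps the
  infimum at most \<open>D\<close>, while homogeneity makes it at least
  \<open>(1 + e) * D\<close>.\<close>

lemma ex_dominant:
  fixes f :: "'a::{metric_space,finite} \<Rightarrow> real"
  assumes sn: "seminorm_on (TP :: ('a \<Rightarrow> real) set) inf_K_norm"
    and f: "f \<in> TP" and "D > 0" and D: "D \<le> inf_K_norm f"
    and le: "\<And>l. 1-lipschitz_on UNIV l \<Longrightarrow> pairing l f \<le> D"
  shows "\<exists>u v. dominant D f u v"
proof (rule ccontr)
  assume "\<nexists>u v. dominant D f u v"
  then have "\<forall>\<^sub>F e in at_right 0. inf_K_norm (\<lambda>v. f v + e * f v) \<le> D + e * pairing (\<lambda>_. 0) f"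
    using inf_K_norm_perturb[OF f f \<open>D > 0\<close> le, of "\<lambda>_. 0"] by blast
  then have "\<forall>\<^sub>F e in at_right (0::real). inf_K_norm (\<lambda>v. f v + e * f v) \<le> D \<and> e > 0"
    using eventually_at_right_less[of "0::real"]
    by eventually_elim (simp add: pairing_def)
  then obtain e :: real where e: "inf_K_norm (\<lambda>v. f v + e * f v) \<le> D" "e > 0"
    using eventually_happens'[OF trivial_limit_at_right_real] by blast
  have "inf_K_norm (\<lambda>v. f v + e * f v) = (1 + e) * inf_K_norm f"
    using seminorm_on_scale[OF sn f, of "1 + e"] e(2) by (simp add: algebra_simps)
  also have "\<dots> \<ge> (1 + e) * D" using D e(2) by simp
  finally have "D + D * e \<le> D" using e(1) by (simp add: algebra_simps)
  then show False using mult_pos_pos[OF \<open>D > 0\<close> e(2)] by simp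
qed

text \<open>By maximality \<open>T\<close> contains every pair that is dominant for its transport, so all of these
  pairs have the same steep functions, namely those steep on all of \<open>T\<close>; hence the upper bounds of
  \<open>inf_K_norm_perturb\<close> in the directions \<open>g\<close> and \<open>- g\<close> may be evaluated at different
  steep functions \<open>k\<close> and \<open>l\<close>.\<close>

lemma ex_rigid_pair:
  fixes x y :: "'a::{metric_space,finite}"
  assumes sn: "seminorm_on (TP :: ('a \<Rightarrow> real) set) inf_K_norm" and "x \<noteq> y"
  obtains u v where "u \<noteq> v" "\<And>z. dist u v = dist u z + dist z v"
    "dist u y = dist u x + dist x y"
proof -
  define \<T> where "\<T> = {T. (x, y) \<in> T \<and> cost T \<le> inf_K_norm (transport T)}"
  have "{(x, y)} \<in> \<T>"
    unfolding \<T>_def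
    by (auto intro!: inf_K_norm_ge[of _ x y] transport_TP simp: pairing_transport cost_def steep_def)
  then obtain T where T: "T \<in> \<T>" and maxT: "\<And>S. S \<in> \<T> \<Longrightarrow> T \<subseteq> S \<Longrightarrow> S = T"
    using finite_has_maximal[OF finite, of \<T>] by (metis empty_iff)
  let ?f = "transport T" and ?D = "cost T"
  have xyT: "(x, y) \<in> T" using T by (simp add: \<T>_def)
  have normT: "?D \<le> inf_K_norm ?f" using T by (simp add: \<T>_def)
  have "dist x y \<le> ?D"
    unfolding cost_def using member_le_sum[OF xyT, of "\<lambda>(a, b). dist a b"] by auto
  then have Dpos: "?D > 0" using \<open>x \<noteq> y\<close> by (meson less_le_trans zero_less_dist_iff)
  \<comment> \<open>If \<open>(u, v)\<close> is dominant, every function steep on it is steep on all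
    of \<open>T\<close>, and so attains the cost of the enlarged set too. Maximality then forbids a
    proper enlargement.\<close>
  have in_T: "(u, v) \<in> T" if dom: "dominant ?D ?f u v" for u v
  proof (rule ccontr)
    assume nin: "(u, v) \<notin> T"
    have "cost (insert (u, v) T) \<le> inf_K_norm (transport (insert (u, v) T))"
    proof (rule inf_K_norm_ge[OF transport_TP])
      fix l assume "steep u v l"
      then have "\<forall>(a, b)\<in>insert (u, v) T. steep a b l"
        using dom pairing_transport_eq_iff[of l T] by (auto simp: dominant_def steep_def)
      then show "cost (insert (u, v) T) \<le> pairing l (transport (insert (u, v) T))"
        using pairing_transport_eq_iff[of l "insert (u, v) T"] \<open>steep u v l\<close>
        by (metis order_refl steep_def)
    qed
    then have "insert (u, v) T \<in> \<T>" using xyT by (simp add: \<T>_def)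
    then show False using maxT[of "insert (u, v) T"] nin by blast
  qed
  obtain u v where dom: "dominant ?D ?f u v"
    using ex_dominant[OF sn transport_TP Dpos normT pairing_transport_le] by blast
  have steepT: "steep a b l" if "steep u v l" "(a, b) \<in> T" for a b l
    using that dom pairing_transport_eq_iff[of l T] by (auto simp: dominant_def steep_def)
  have le: "pairing l g \<le> pairing k g" if k: "steep u v k" and l: "steep u v l" and g: "g \<in> TP"
    for k l g
  proof -
    have ng: "(\<lambda>v. - g v) \<in> TP" using TP_lincomb[OF g g, of "-1" 0] by simp
    have "\<forall>\<^sub>F e in at_right 0. inf_K_norm (\<lambda>v. ?f v + e * g v) \<le> ?D + e * pairing k g"
      by (rule inf_K_norm_perturb[OF transport_TP g Dpos pairing_transport_le])
        (auto intro: steepT[OF k] in_T)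
    moreover have "\<forall>\<^sub>F e in at_right 0. inf_K_norm (\<lambda>v. ?f v + e * - g v)
        \<le> ?D + e * pairing l (\<lambda>v. - g v)"
      by (rule inf_K_norm_perturb[OF transport_TP ng Dpos pairing_transport_le])
        (auto intro: steepT[OF l] in_T)
    ultimately have "\<forall>\<^sub>F e in at_right 0. e > 0 \<and>
        inf_K_norm (\<lambda>v. ?f v + e * g v) \<le> ?D + e * pairing k g \<and>
        inf_K_norm (\<lambda>v. ?f v + e * - g v) \<le> ?D + e * pairing l (\<lambda>v. - g v)"
      using eventually_at_right_less[of "0::real"] by eventually_elim auto
    then obtain e :: real where e: "e > 0"
        "inf_K_norm (\<lambda>v. ?f v + e * g v) \<le> ?D + e * pairing k g"
        "inf_K_norm (\<lambda>v. ?f v + e * - g v) \<le> ?D + e * pairing l (\<lambda>v. - g v)"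
      using eventually_happens'[OF trivial_limit_at_right_real] by blast
    have ming: "pairing l (\<lambda>v. - g v) = - pairing l g"
      using pairing_lincomb[of l "-1" g 0 g] by simp
    \<comment> \<open>Subadditivity at the midpoint \<open>?f\<close> of the two perturbations: the
      first-order terms of the upper bounds must have nonnegative sum.\<close>
    have "2 * ?D \<le> 2 * inf_K_norm ?f" using normT by simp
    also have "\<dots> = inf_K_norm (\<lambda>v. 2 * ?f v)"
      using seminorm_on_scale[OF sn transport_TP, of 2] by simp
    also have "\<dots> = inf_K_norm (\<lambda>v. (?f v + e * g v) + (?f v + e * - g v))"
      by (simp add: algebra_simps)
    also have "\<dots> \<le> inf_K_norm (\<lambda>v. ?f v + e * g v) + inf_K_norm (\<lambda>v. ?f v + e * - g v)"
    proof -
      have "(\<lambda>v. ?f v + e * g v) \<in> TP" "(\<lambda>v. ?f v + e * - g v) \<in> TP"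
        using TP_lincomb[OF transport_TP g, of 1 T e] TP_lincomb[OF transport_TP ng, of 1 T e]
        by simp_all
      then show ?thesis by (rule seminorm_on_add[OF sn])
    qed
    also have "\<dots> \<le> 2 * ?D + e * pairing k g - e * pairing l g" using e ming by simp
    finally show ?thesis using e(1) by simp
  qed
  show ?thesis
  proof
    show "u \<noteq> v" using dom by (simp add: dominant_def)
    \<comment> \<open>Testing with unit mass moved from \<open>u\<close> to \<open>z\<close> gives
      \<open>dist u z \<le> dist u v - dist v z\<close>, the reverse of the triangle
      inequality.\<close>
    show "dist u v = dist u z + dist z v" for z
      using le[OF steep_dist_to steep_dist_from transport_TP[of "{(u, z)}"]] dist_triangle[of u v z]
      by (simp add: pairing_transport dist_commute)
    show "dist u y = dist u x + dist x y"
      using steepT[OF steep_dist_from xyT] by (simp add: steep_def)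
  qed
qed

section \<open>Linear tuples and verification of the min-condition\<close>

lemma linear_triple_iff:
  "linear_triple u x v \<longleftrightarrow> x \<noteq> u \<and> x \<noteq> v \<and> dist u v = dist u x + dist x v"
proof -
  have "(\<forall>i j k. i < j \<and> j < k \<and> k < length [u, x, v] \<longrightarrow> P i j k) \<longleftrightarrow> P 0 1 2"
    for P :: "nat \<Rightarrow> nat \<Rightarrow> nat \<Rightarrow> bool"
  proof (intro iffI allI impI)
    fix i j k :: nat assume "P 0 1 2" "i < j \<and> j < k \<and> k < length [u, x, v]"
    moreover from this(2) have "i = 0" "j = 1" "k = 2" by auto
    ultimately show "P i j k" by simp
  qed simp
  note * = this
  show ?thesis
    unfolding linear_triple_def linear_tuple_def * by (auto simp: dist_commute)
qed

lemma linear_tuple_4: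
  "linear_tuple [u, x, y, v] \<longleftrightarrow>
     0 < dist u x \<and> dist u x < dist u y \<and> dist u y < dist u v \<and>
     dist u y = dist u x + dist x y \<and> dist u v = dist u x + dist x v \<and>
     dist u v = dist u y + dist y v \<and> dist x v = dist x y + dist y v"
proof -
  have "(\<forall>i j k. i < j \<and> j < k \<and> k < length [u, x, y, v] \<longrightarrow> P i j k) \<longleftrightarrow>
      P 0 1 2 \<and> P 0 1 3 \<and> P 0 2 3 \<and> P 1 2 3"
    for P :: "nat \<Rightarrow> nat \<Rightarrow> nat \<Rightarrow> bool"
  proof (intro iffI allI impI)
    fix i j k :: nat assume P: "P 0 1 2 \<and> P 0 1 3 \<and> P 0 2 3 \<and> P 1 2 3"
      and "i < j \<and> j < k \<and> k < length [u, x, y, v]"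
    then have "(i, j, k) \<in> {(0, 1, 2), (0, 1, 3), (0, 2, 3), (1, 2, 3)}" by auto
    then show "P i j k" using P by auto
  qed simp
  note * = this
  have "sorted_wrt (<) (map (\<lambda>r. dist r ([u, x, y, v] ! 0)) [u, x, y, v]) \<longleftrightarrow>
      0 < dist u x \<and> dist u x < dist u y \<and> dist u y < dist u v"
    by (auto simp: dist_commute)
  note ** = this
  show ?thesis
    unfolding linear_tuple_def * **
    by (simp add: numeral_2_eq_2 numeral_3_eq_3)
qed

lemma exactly_one_4:
  "exactly_one [a, b, c, d] \<longleftrightarrow>
     a \<and> \<not> b \<and> \<not> c \<and> \<not> d \<or> \<not> a \<and> b \<and> \<not> c \<and> \<not> d \<or>
     \<not> a \<and> \<not> b \<and> c \<and> \<not> d \<or> \<not> a \<and> \<not> b \<and> \<not> c \<and> d"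
proof -
  have "k < length [a, b, c, d] \<and> [a, b, c, d] ! k \<longleftrightarrow>
      k = 0 \<and> a \<or> k = 1 \<and> b \<or> k = 2 \<and> c \<or> k = 3 \<and> d" for k
    by (simp add: nth_Cons less_Suc_eq numeral_2_eq_2 numeral_3_eq_3 split: nat.split) 
  note * = this
  show ?thesis
    unfolding exactly_one_def * Ex1_def
    by (cases a; cases b; cases c; cases d; simp; presburger)
qed

theorem corollary2p5:
  assumes "CARD('a::{metric_space,finite}) \<ge> 2"
    and "\<not> min_condition TYPE('a)"
  shows "\<not> seminorm_on (TP :: ('a \<Rightarrow> real) set) inf_K_norm"
proof
  assume sn: "seminorm_on (TP :: ('a \<Rightarrow> real) set) inf_K_norm"
  \<comment> \<open>All rigid pairs are taken at once; finiteness is automatic on a finite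
    space.\<close>
  define P where "P = {(u, v). u \<noteq> v \<and> (\<forall>z::'a. dist u v = dist u z + dist z v)}"
  have "\<exists>(u, v)\<in>P. exactly_one
           [{x, y} = {u, v},
            (x \<in> {u, v} \<and> y \<notin> {u, v} \<and> linear_triple u y v) \<or>
              (y \<in> {u, v} \<and> x \<notin> {u, v} \<and> linear_triple u x v),
            linear_tuple [u, x, y, v],
            linear_tuple [u, y, x, v]]" if neq: "x \<noteq> y" for x y :: 'a
  proof -
    obtain u v where uv: "u \<noteq> v" "\<And>z. dist u v = dist u z + dist z v"
      "dist u y = dist u x + dist x y"
      using ex_rigid_pair[OF sn neq] by blast
    have pos: "dist x y > 0" using neq by simp
    have yu: "y \<noteq> u" using uv(3) pos zero_le_dist[of u x] dist_self[of u] by force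
    have xv: "x \<noteq> v"
      using uv(2)[of y] uv(3) pos zero_le_dist[of y v] by (auto simp: dist_commute)
    have xyv: "dist x v = dist x y + dist y v" using uv(2)[of x] uv(2)[of y] uv(3) by simp
    have less: "dist u x < dist u y" using uv(3) pos by simp
    then have nless: "\<not> dist u y < dist u x" by simp
    have "exactly_one
           [{x, y} = {u, v},
            (x \<in> {u, v} \<and> y \<notin> {u, v} \<and> linear_triple u y v) \<or>
              (y \<in> {u, v} \<and> x \<notin> {u, v} \<and> linear_triple u x v),
            linear_tuple [u, x, y, v],
            linear_tuple [u, y, x, v]]"
    \<comment> \<open>The pair is oriented so that \<open>x\<close> is nearer to \<open>u\<close>
      than \<open>y\<close>, which rules out alternative (4). The cases yield (1), (2) with
      \<open>y\<close> inside, (2) with \<open>x\<close> inside, and (3).\<close>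
    proof (cases "x = u"; cases "y = v")
      assume "x = u" "y = v"
      then show ?thesis by (simp add: exactly_one_4 linear_tuple_4)
    next
      assume "x = u" "y \<noteq> v"
      then show ?thesis using yu uv(1) uv(2)[of y]
        by (simp add: exactly_one_4 linear_triple_iff linear_tuple_4 doubleton_eq_iff)
    next
      assume "x \<noteq> u" "y = v"
      then show ?thesis using xv yu uv(2)[of x] nless
        by (simp add: exactly_one_4 linear_triple_iff linear_tuple_4 doubleton_eq_iff)
    next
      assume "x \<noteq> u" "y \<noteq> v"
      then have "0 < dist u x" "dist u y < dist u v" using uv(2)[of y] by auto
      then have "linear_tuple [u, x, y, v]"
        unfolding linear_tuple_4 using less uv(2,3) xyv by blast
      moreover have "\<not> linear_tuple [u, y, x, v]"
        unfolding linear_tuple_4 using nless by blast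
      ultimately show ?thesis
        using \<open>x \<noteq> u\<close> \<open>y \<noteq> v\<close> xv yu unfolding exactly_one_4 by blast
    qed
    moreover have "(u, v) \<in> P" using uv by (simp add: P_def)
    ultimately show ?thesis by blast
  qed
  moreover have "finite P" "\<forall>(u, v)\<in>P. u \<noteq> v"
    "\<forall>(u, v)\<in>P. \<forall>x. x \<noteq> u \<and> x \<noteq> v \<longrightarrow> linear_triple u x v"
    by (auto simp: P_def linear_triple_iff)
  ultimately have "min_condition TYPE('a)" unfolding min_condition_def by blast
  with assms(2) show False ..
qed

end
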